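(* Let $f=f_1+f_2$ on $\mathbb{R}^m$ and $g=g_1+g_2$ on $\mathbb{R}^n$, where $f_1:\mathbb{R}^m\to\mathbb{R}\cup\{+\infty\}$ is proper, closed and convex; $f_2:\mathbb{R}^m\to\mathbb{R}$ is convex with $L_{f_2}$-Lipschitz continuous gradient; $g_1:\mathbb{R}^n\to\mathbb{R}\cup\{+\infty\}$ is proper, closed and $\mu_g$-strongly convex ($\mu_g>0$); $g_2:\mathbb{R}^n\to\mathbb{R}$ is convex with $L_{g_2}$-Lipschitz continuous gradient. Let $A\in\mathbb{R}^{p\times m}$, $B\in\mathbb{R}^{p\times n}$, $b\in\mathbb{R}^p$, let $\mathcal{L}(x,y,\lambda)=f(x)+g(y)+\langle\lambda,Ax+By-b\rangle$, and suppose its set of saddle points $\Omega$ is nonempty. Let $\{(x_k,y_k)\}_{k\ge1}$ be generated by Algorithm 5 (described in the context) with parameters $\alpha,\beta,\gamma>0$, and let $(x^*,y^*,\lambda^* )\in\Omega$. Assume $\alpha\le \frac{1}{L_{f_2}}$, $\beta\le\frac{t_1^2}{L_{g_2}}$, and that $\{t_k\}_{k\ge1}\subseteq[1,+\infty)$ is a nondecreasing sequence satisfying, for all $k\ge1$, $$t_{k+1}^2\le t_k^2+t_{k+1}\quad\text{and}\quad t_{k+1}^2\le t_k^2+\frac{\beta\mu_g}{1+\beta\gamma\|B\|^2}\,t_k .$$ Then for all $k\ge1$: $$\mathcal{L}(x_k,y_k,\lambda^* )-\mathcal{L}(x^*,y^*,\lambda^* )\le\frac{\mathcal{E}_1+\frac{\gamma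 t_2^2}{2}\|B(y_1-y^* )\|^2}{t_k^2},$$ $$\|Ax_k+By_k-b\|\le\frac{C_1}{t_k^2},$$ $$|f(x_k)+g(y_k)-f(x^* )-g(y^* )|\le\frac{\mathcal{E}_1+\frac{\gamma t_2^2}{2}\|B(y_1-y^* )\|^2+C_1\|\lambda^*\|}{t_k^2},$$ where $$\mathcal{E}_1=t_1^2\big(\mathcal{L}(x_1,y_1,\lambda^* )-\mathcal{L}(x^*,y^*,\lambda^* )\big)+\frac{1}{2\alpha}\|x_1-x^*\|^2+\frac{t_2^2}{2\beta}\|y_1-y^*\|^2+\frac{1}{2\gamma}\|\lambda_1-\lambda^*\|^2,$$ $$C_1=3t_1^2\|Ax_1+By_1-b\|+\frac{2\|\lambda_1-\lambda^*\|+2\sqrt{2\gamma\mathcal{E}_1+\gamma^2t_2^2\|B(y_1-y^* )\|^2}}{\gamma}.$$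
   Context: Norms are Euclidean (operator norm for matrices). $dom(F)=\{x: F(x)<+\infty\}$; $F$ is proper if $dom(F)\ne\emptyset$; $F$ is closed if $F(x)\le\liminf_{y\to x}F(y)$ for all $x$ and $dom(F)$ is closed. $1/0$ is read as $+\infty$ in step-size bounds. $\mu_g$-strong convexity of $g_1$ means $g_1(y_2)-g_1(y_1)-\langle\xi,y_2-y_1\rangle\ge\frac{\mu_g}{2}\|y_2-y_1\|^2$ for all $y_1,y_2$ and $\xi\in\partial g_1(y_1)$. A saddle point is a triple $(x^*,y^*,\lambda^* )$ with $\mathcal{L}(x^*,y^*,\lambda)\le\mathcal{L}(x^*,y^*,\lambda^* )\le\mathcal{L}(x,y,\lambda^* )$ for all $(x,y,\lambda)$. Algorithm 5 (for $\min f(x)+g(y)$ s.t. $Ax+By=b$). Initialize $x_1=x_0=u_1\in dom(f)$, $y_1=y_0=v_1\in dom(g)$, $\lambda_1\in\mathbb{R}^p$. For $k=1,2,\dots$: - $(\bar x_k,\bar y_k)=(x_k,y_k)+\frac{t_k-1}{t_{k+1}}[(x_k,y_k)-(x_{k-1},y_{k-1})]$; - $u_{k+1}=\arg\min_u\big(f_1(u)+\langle A^T\lambda_k+\nabla f_2(\bar x_k),u\rangle+\frac{\gamma t_{k+1}}{2}\|Au+Bv_k-b\|^2+\frac{1}{2\alpha t_{k+1}}\|u-u_k\|^2\big)$; - $v_{k+1}=\arg\min_v\big(g_1(v)+\langle B^T\lambda_k+\nabla g_2(\bar y_k),v\rangle+\frac{\gamma t_{k+1}}{2}\|Au_{k+1}+Bv-b\|^2+\frac{t_{k+1}}{2\beta}\|v-v_k\|^2\big)$;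 - $(x_{k+1},y_{k+1})=\frac{1}{t_{k+1}}(u_{k+1},v_{k+1})+\frac{t_{k+1}-1}{t_{k+1}}(x_k,y_k)$; - $\lambda_{k+1}=\lambda_k+\gamma t_{k+1}(Au_{k+1}+Bv_{k+1}-b)$. *)

theory Defs
  imports "HOL-Analysis.Analysis"
begin

(* A function into the reals extended by +\<infinity> is an ereal-valued function that never
   takes the value -\<infinity>; the latter is part of properness below. *)

definition effdom :: "('a \<Rightarrow> ereal) \<Rightarrow> 'a set" where
  "effdom F = {x. F x < \<infinity>}"

definition proper_fun :: "('a \<Rightarrow> ereal) \<Rightarrow> bool" where
  "proper_fun F \<longleftrightarrow> (\<forall>x. F x \<noteq> -\<infinity>) \<and> effdom F \<noteq> {}"

definition closed_fun :: "('a::topological_space \<Rightarrow> ereal) \<Rightarrow> bool" where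
  "closed_fun F \<longleftrightarrow> (\<forall>x. F x \<le> Liminf (at x) F) \<and> closed (effdom F)"

(* Meant for functions that avoid -\<infinity>, so that no sum of opposite infinities arises;
   at the endpoints ereal has 0 * \<infinity> = 0, which makes the inequality trivial. *)
definition convex_fun :: "('a::real_vector \<Rightarrow> ereal) \<Rightarrow> bool" where
  "convex_fun F \<longleftrightarrow>
    (\<forall>x y u v. 0 \<le> u \<and> 0 \<le> v \<and> u + v = 1 \<longrightarrow>
      F (u *\<^sub>R x + v *\<^sub>R y) \<le> ereal u * F x + ereal v * F y)"

definition subdifferential :: "('a::real_inner \<Rightarrow> ereal) \<Rightarrow> 'a \<Rightarrow> 'a set" where
  "subdifferential F x =
    {\<xi>. x \<in> effdom F \<and> (\<forall>y. F x + ereal (inner \<xi> (y - x)) \<le> F y)}"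

(* Convexity is required separately: the inequality alone says nothing at points
   without subgradients. *)
definition strongly_convex_fun :: "real \<Rightarrow> ('a::real_inner \<Rightarrow> ereal) \<Rightarrow> bool" where
  "strongly_convex_fun \<mu> F \<longleftrightarrow> convex_fun F \<and>
    (\<forall>y1 y2. \<forall>\<xi> \<in> subdifferential F y1.
      ereal (\<mu> / 2 * (norm (y2 - y1))\<^sup>2) \<le> F y2 - F y1 - ereal (inner \<xi> (y2 - y1)))"

definition lagrangian ::
  "(real^'m \<Rightarrow> ereal) \<Rightarrow> (real^'n \<Rightarrow> ereal) \<Rightarrow> real^'m^'p \<Rightarrow> real^'n^'p \<Rightarrow> real^'p \<Rightarrow>
   real^'m \<Rightarrow> real^'n \<Rightarrow> real^'p \<Rightarrow> ereal" where
  "lagrangian f g A B b x y l = f x + g y + ereal (inner l (A *v x + B *v y - b))"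

definition saddle_points :: "('a \<Rightarrow> 'b \<Rightarrow> 'c \<Rightarrow> ereal) \<Rightarrow> ('a \<times> 'b \<times> 'c) set" where
  "saddle_points L = {(xs, ys, ls).
    \<forall>x y l. L xs ys l \<le> L xs ys ls \<and> L xs ys ls \<le> L x y ls}"

(* df2 and dg2 are the gradient maps of f2 and g2. The argument f1 enters the initialisation
   x 1 \<in> effdom f1 because the smooth part f2 is finite everywhere, so that
   f1 + f2 and f1 have the same effective domain; likewise for g1. *)
definition accelerated_linearized_admm ::
  "(real^'m \<Rightarrow> ereal) \<Rightarrow> (real^'m \<Rightarrow> real^'m) \<Rightarrow> (real^'n \<Rightarrow> ereal) \<Rightarrow> (real^'n \<Rightarrow> real^'n) \<Rightarrow>
   real^'m^'p \<Rightarrow> real^'n^'p \<Rightarrow> real^'p \<Rightarrow> real \<Rightarrow> real \<Rightarrow> real \<Rightarrow> (nat \<Rightarrow> real) \<Rightarrow>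
   (nat \<Rightarrow> real^'m) \<Rightarrow> (nat \<Rightarrow> real^'n) \<Rightarrow> (nat \<Rightarrow> real^'m) \<Rightarrow> (nat \<Rightarrow> real^'n) \<Rightarrow>
   (nat \<Rightarrow> real^'p) \<Rightarrow> bool" where
  "accelerated_linearized_admm f1 df2 g1 dg2 A B b \<alpha> \<beta> \<gamma> t x y u v lam \<longleftrightarrow>
    x 1 = x 0 \<and> x 1 = u 1 \<and> x 1 \<in> effdom f1 \<and>
    y 1 = y 0 \<and> y 1 = v 1 \<and> y 1 \<in> effdom g1 \<and>
    (\<forall>k\<ge>1.
      (let xbar = x k + ((t k - 1) / t (k + 1)) *\<^sub>R (x k - x (k - 1));
           ybar = y k + ((t k - 1) / t (k + 1)) *\<^sub>R (y k - y (k - 1))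
       in
         is_arg_min
           (\<lambda>w. f1 w + ereal (inner (transpose A *v lam k + df2 xbar) w
                 + \<gamma> * t (k + 1) / 2 * (norm (A *v w + B *v v k - b))\<^sup>2
                 + 1 / (2 * \<alpha> * t (k + 1)) * (norm (w - u k))\<^sup>2))
           (\<lambda>_. True) (u (k + 1)) \<and>
         is_arg_min
           (\<lambda>w. g1 w + ereal (inner (transpose B *v lam k + dg2 ybar) w
                 + \<gamma> * t (k + 1) / 2 * (norm (A *v u (k + 1) + B *v w - b))\<^sup>2
                 + t (k + 1) / (2 * \<beta>) * (norm (w - v k))\<^sup>2))
           (\<lambda>_. True) (v (k + 1)) \<and>
         x (k + 1) = (1 / t (k + 1)) *\<^sub>R u (k + 1) + ((t (k + 1) - 1) / t (k + 1)) *\<^sub>R x k \<and>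
         y (k + 1) = (1 / t (k + 1)) *\<^sub>R v (k + 1) + ((t (k + 1) - 1) / t (k + 1)) *\<^sub>R y k \<and>
         lam (k + 1) = lam k + (\<gamma> * t (k + 1)) *\<^sub>R (A *v u (k + 1) + B *v v (k + 1) - b)))"

end

theory Submission
  imports Defs
begin

text \<open>Write \<open>h k\<close> for the Lagrangian gap at the \<open>k\<close>-th iterate. The energy
  \<open>(t k)\<^sup>2 * h k + |u k - xs|\<^sup>2 / (2 * \<alpha>) + (t (k + 1))\<^sup>2 * |v k - ys|\<^sup>2 / (2 * \<beta>)
  + |lam k - ls|\<^sup>2 / (2 * \<gamma>) + \<gamma> * (t (k + 1))\<^sup>2 * |B (v k - ys)|\<^sup>2 / 2\<close>
  does not increase. The last term pays for the fact that the \<open>u\<close>-update sees \<open>B v k\<close> instead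
  of \<open>B v (k + 1)\<close>, and strong convexity of \<open>g1\<close> pays for the growth of \<open>t\<close> in front of the
  two \<open>v\<close>-terms. This bounds the gap and the multipliers. The multiplier update reads
  \<open>(t (k + 1))\<^sup>2 s (k + 1) - t (k + 1) (t (k + 1) - 1) s k = (lam (k + 1) - lam k) / \<gamma>\<close> for the
  residuals \<open>s\<close>, and \<open>t (k + 1) (t (k + 1) - 1) \<le> (t k)\<^sup>2\<close>, so bounded multipliers give
  bounded \<open>(t k)\<^sup>2 s k\<close> by an averaging argument. The objective bound combines the two.\<close>

section \<open>First-order inequalities for convex and smooth functions\<close>

text \<open>Restricting \<open>h\<close> to the line through \<open>x\<close> and \<open>y\<close>
  leaves a convex function of one real variable, for which the tangent inequality is
  \<open>convex_on_imp_above_tangent\<close>.\<close>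

lemma convex_above_gradient:
  fixes h :: "'a::real_inner \<Rightarrow> real"
  assumes "convex_on UNIV h" and "GDERIV h x :> D"
  shows "h x + inner D (y - x) \<le> h y"
proof -
  have "convex_on UNIV (\<lambda>s::real. h (x + s *\<^sub>R (y - x)))"
  proof (rule convex_onI)
    fix t a b :: real assume t: "0 < t" "t < 1"
    have "x + ((1 - t) *\<^sub>R a + t *\<^sub>R b) *\<^sub>R (y - x)
        = (1 - t) *\<^sub>R (x + a *\<^sub>R (y - x)) + t *\<^sub>R (x + b *\<^sub>R (y - x))"
      by (simp add: algebra_simps)
    then show "h (x + ((1 - t) *\<^sub>R a + t *\<^sub>R b) *\<^sub>R (y - x))
        \<le> (1 - t) * h (x + a *\<^sub>R (y - x)) + t * h (x + b *\<^sub>R (y - x))"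
      using convex_onD[OF assms(1), of t] t by simp
  qed simp
  moreover have "((\<lambda>s::real. h (x + s *\<^sub>R (y - x))) has_real_derivative inner D (y - x)) (at 0)"
  proof -
    have "(h has_derivative (\<lambda>d. inner d D)) (at (x + 0 *\<^sub>R (y - x)))"
      using assms(2) by (simp add: gderiv_def)
    then have "((\<lambda>s::real. h (x + s *\<^sub>R (y - x))) has_derivative
        (\<lambda>s. inner (s *\<^sub>R (y - x)) D)) (at 0)"
      by (rule has_derivative_compose[rotated]) (auto intro!: derivative_eq_intros)
    then show ?thesis
      by (simp add: has_field_derivative_def inner_commute mult.commute[of _ "inner D (y - x)"])
  qed
  ultimately have "h (x + 1 *\<^sub>R (y - x)) - h (x + 0 *\<^sub>R (y - x)) \<ge> inner D (y - x) * (1 - 0)"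
    by (intro convex_on_imp_above_tangent[where A = UNIV]) auto
  then show ?thesis by simp
qed

text \<open>This lets the merely convex block \<open>f1\<close> and the strongly convex block
  \<open>g1\<close> share \<open>accelerated_composite_step\<close>. For modulus 0 the claim is the
  subgradient inequality itself; finiteness at \<open>y1\<close> justifies rearranging it in
  \<open>ereal\<close>.\<close>

lemma proper_convex_imp_strongly_convex_zero:
  assumes "proper_fun F" "convex_fun F"
  shows "strongly_convex_fun 0 F"
  unfolding strongly_convex_fun_def
proof (intro conjI allI ballI)
  fix y1 y2 \<xi> assume "\<xi> \<in> subdifferential F y1"
  then have "F y1 < \<infinity>" "F y1 + ereal (inner \<xi> (y2 - y1)) \<le> F y2" "F y1 \<noteq> - \<infinity>"
    using assms(1) by (auto simp: subdifferential_def effdom_def proper_fun_def)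
  then show "ereal (0 / 2 * (norm (y2 - y1))\<^sup>2) \<le> F y2 - F y1 - ereal (inner \<xi> (y2 - y1))"
    by (cases "F y1"; cases "F y2") auto
qed (rule assms(2))

text \<open>The descent lemma, obtained without integration: \<open>\<phi>\<close> is
  \<open>h\<close> along the segment minus its linear and quadratic terms, and Cauchy-Schwarz with
  the Lipschitz bound makes its derivative nonpositive on [0,1].\<close>

lemma lipschitz_gradient_descent:
  fixes h :: "'a::real_inner \<Rightarrow> real"
  assumes der: "\<And>z. GDERIV h z :> D z" and lip: "C-lipschitz_on UNIV D"
  shows "h y \<le> h x + inner (D x) (y - x) + C / 2 * (norm (y - x))\<^sup>2"
proof -
  define d where "d = y - x"
  define \<phi> where "\<phi> s = h (x + s *\<^sub>R d) - s * inner (D x) d - C / 2 * s\<^sup>2 * (norm d)\<^sup>2" for s :: real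
  have "\<phi> 1 \<le> \<phi> 0"
  proof (rule DERIV_nonpos_imp_nonincreasing[of 0 1 \<phi>])
    fix s :: real assume s: "0 \<le> s" "s \<le> 1"
    have "(h has_derivative (\<lambda>e. inner e (D (x + s *\<^sub>R d)))) (at (x + s *\<^sub>R d))"
      using der by (simp add: gderiv_def)
    then have "((\<lambda>s::real. h (x + s *\<^sub>R d)) has_derivative
        (\<lambda>r. inner (r *\<^sub>R d) (D (x + s *\<^sub>R d)))) (at s)"
      by (rule has_derivative_compose[rotated]) (auto intro!: derivative_eq_intros)
    then have "((\<lambda>s::real. h (x + s *\<^sub>R d)) has_real_derivative inner (D (x + s *\<^sub>R d)) d) (at s)"
      by (simp add: has_field_derivative_def inner_commute mult.commute[of _ "inner _ _"])
    then have "(\<phi> has_real_derivative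
        (inner (D (x + s *\<^sub>R d)) d - inner (D x) d - C * s * (norm d)\<^sup>2)) (at s)"
      unfolding \<phi>_def by (auto intro!: derivative_eq_intros simp: power2_eq_square)
    moreover have "inner (D (x + s *\<^sub>R d)) d - inner (D x) d \<le> C * s * (norm d)\<^sup>2"
    proof -
      have "inner (D (x + s *\<^sub>R d)) d - inner (D x) d \<le> norm (D (x + s *\<^sub>R d) - D x) * norm d"
        by (metis inner_diff_left norm_cauchy_schwarz)
      also have "norm (D (x + s *\<^sub>R d) - D x) \<le> C * norm (s *\<^sub>R d)"
        using lipschitz_onD[OF lip, of "x + s *\<^sub>R d" x] by (simp add: dist_norm)
      finally show ?thesis using s by (simp add: power2_eq_square mult_right_mono)
    qed
    ultimately show "\<exists>y. (\<phi> has_real_derivative y) (at s) \<and> y \<le> 0" by auto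
  qed simp
  then show ?thesis by (simp add: \<phi>_def d_def)
qed

lemma effdom_imp_real:
  assumes "proper_fun F" "z \<in> effdom F"
  shows "F z = ereal (real_of_ereal (F z))"
  using assms by (cases "F z") (auto simp: proper_fun_def effdom_def)

lemma convex_combination_effdom:
  assumes F: "proper_fun F" "convex_fun F" and dom: "a \<in> effdom F" "c \<in> effdom F"
    and w: "0 \<le> p" "0 \<le> q" "p + q = 1"
  shows "p *\<^sub>R a + q *\<^sub>R c \<in> effdom F"
    and "real_of_ereal (F (p *\<^sub>R a + q *\<^sub>R c)) \<le> p * real_of_ereal (F a) + q * real_of_ereal (F c)"
proof -
  have "F (p *\<^sub>R a + q *\<^sub>R c) \<le> ereal p * F a + ereal q * F c"
    using F(2) w by (auto simp: convex_fun_def)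
  also have "\<dots> = ereal (p * real_of_ereal (F a) + q * real_of_ereal (F c))"
    using effdom_imp_real[OF F(1) dom(1)] effdom_imp_real[OF F(1) dom(2)]
    by (metis plus_ereal.simps(1) times_ereal.simps(1))
  finally have le: "F (p *\<^sub>R a + q *\<^sub>R c) \<le> ereal (p * real_of_ereal (F a) + q * real_of_ereal (F c))" .
  then show "p *\<^sub>R a + q *\<^sub>R c \<in> effdom F"
    by (auto simp: effdom_def intro: le_less_trans)
  from le effdom_imp_real[OF F(1) this]
  show "real_of_ereal (F (p *\<^sub>R a + q *\<^sub>R c)) \<le> p * real_of_ereal (F a) + q * real_of_ereal (F c)"
    by (metis ereal_less_eq(3))
qed

section \<open>Optimality conditions of the subproblems\<close>

text \<open>Dividing by \<open>s\<close> and letting \<open>s\<close> tend to 0 from the right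
  removes the quadratic term. This extracts a first-order condition where one summand is not
  differentiable.\<close>

lemma quadratic_term_nonneg_limit:
  fixes a q :: real
  assumes "\<And>s. 0 < s \<Longrightarrow> s \<le> 1 \<Longrightarrow> 0 \<le> s * a + s\<^sup>2 * q"
  shows "0 \<le> a"
proof (rule tendsto_lowerbound)
  show "((\<lambda>s. a + s * q) \<longlongrightarrow> a) (at_right 0)"
    by (auto intro!: tendsto_eq_intros)
  show "\<forall>\<^sub>F s in at_right 0. 0 \<le> a + s * q"
    unfolding eventually_at_right_field
  proof (intro exI[of _ 1] conjI allI impI)
    fix s :: real assume s: "0 < s" "s < 1"
    then have "0 \<le> s * (a + s * q)"
      using assms[of s] by (simp add: algebra_simps power2_eq_square)
    then show "0 \<le> a + s * q" using s by (simp add: zero_le_mult_iff)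
  qed simp
qed simp

lemma inner_transpose_matrix_vector:
  fixes M :: "real^'a^'b"
  shows "inner (transpose M *v w) d = inner w (M *v d)"
  by (metis dot_lmul_matrix inner_commute transpose_matrix_vector)

text \<open>Fermat's rule without a sum rule for subdifferentials: on moving from \<open>z\<close>
  towards \<open>w\<close> by a fraction \<open>s\<close>, convexity bounds the change of
  \<open>F\<close> linearly in \<open>s\<close>, the quadratic part expands exactly, and the
  order-\<open>s\<close> term must be nonnegative.\<close>

lemma arg_min_quadratic_subgradient:
  fixes F :: "real^'a \<Rightarrow> ereal" and M :: "real^'a^'b"
  assumes F: "proper_fun F" "convex_fun F"
    and min: "is_arg_min (\<lambda>w. F w + ereal (inner c w + \<kappa> / 2 * (norm (M *v w - e))\<^sup>2
                 + \<rho> / 2 * (norm (w - p))\<^sup>2)) (\<lambda>_. True) z"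
  shows "- (c + \<kappa> *\<^sub>R (transpose M *v (M *v z - e)) + \<rho> *\<^sub>R (z - p)) \<in> subdifferential F z"
proof -
  define \<phi> where "\<phi> w = inner c w + \<kappa> / 2 * (norm (M *v w - e))\<^sup>2 + \<rho> / 2 * (norm (w - p))\<^sup>2" for w
  define G where "G = c + \<kappa> *\<^sub>R (transpose M *v (M *v z - e)) + \<rho> *\<^sub>R (z - p)"
  have le: "F z + ereal (\<phi> z) \<le> F w + ereal (\<phi> w)" for w
    using min unfolding is_arg_min_def \<phi>_def by (auto simp: not_less)
  obtain w0 where "F w0 < \<infinity>" using F(1) by (auto simp: proper_fun_def effdom_def)
  then have z: "z \<in> effdom F"
    using le[of w0] unfolding effdom_def by (cases "F z"; cases "F w0") auto
  have expand: "\<phi> (z + s *\<^sub>R d) = \<phi> z + s * inner G d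
      + s\<^sup>2 * (\<kappa> / 2 * (norm (M *v d))\<^sup>2 + \<rho> / 2 * (norm d)\<^sup>2)" for s d
  proof -
    have sq: "(norm (a + s *\<^sub>R r))\<^sup>2 = (norm a)\<^sup>2 + 2 * s * inner a r + s\<^sup>2 * (norm r)\<^sup>2"
      for a r :: "real^'k"
      unfolding power2_norm_eq_inner
      by (simp add: inner_add_left inner_add_right inner_commute[of r a] power2_eq_square algebra_simps)
    have M: "M *v (z + s *\<^sub>R d) - e = (M *v z - e) + s *\<^sub>R (M *v d)"
      by (simp add: matrix_vector_right_distrib matrix_vector_mult_scaleR)
    have p: "z + s *\<^sub>R d - p = (z - p) + s *\<^sub>R d" by simp
    have "inner G d = inner c d + \<kappa> * inner (M *v z - e) (M *v d) + \<rho> * inner (z - p) d"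
      unfolding G_def by (simp only: inner_add_left inner_scaleR_left inner_transpose_matrix_vector)
    then show ?thesis
      unfolding \<phi>_def M p sq inner_add_right inner_scaleR_right by algebra
  qed
  have "F z + ereal (inner (- G) (w - z)) \<le> F w" for w
  proof (cases "w \<in> effdom F")
    case False
    then show ?thesis by (simp add: effdom_def)
  next
    case w: True
    have "0 \<le> real_of_ereal (F w) - real_of_ereal (F z) + inner G (w - z)"
    proof (rule quadratic_term_nonneg_limit)
      fix s :: real assume s: "0 < s" "s \<le> 1"
      have eq: "z + s *\<^sub>R (w - z) = (1 - s) *\<^sub>R z + s *\<^sub>R w" by (simp add: algebra_simps)
      note cc = convex_combination_effdom[OF F z w, of "1 - s" s, folded eq]
      have dom: "z + s *\<^sub>R (w - z) \<in> effdom F"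
        and cv: "real_of_ereal (F (z + s *\<^sub>R (w - z)))
          \<le> (1 - s) * real_of_ereal (F z) + s * real_of_ereal (F w)" using cc s by auto
      have "real_of_ereal (F z) + \<phi> z \<le> real_of_ereal (F (z + s *\<^sub>R (w - z))) + \<phi> (z + s *\<^sub>R (w - z))"
        using le[of "z + s *\<^sub>R (w - z)"] effdom_imp_real[OF F(1) z] effdom_imp_real[OF F(1) dom]
        by (metis ereal_less_eq(3) plus_ereal.simps(1))
      then show "0 \<le> s * (real_of_ereal (F w) - real_of_ereal (F z) + inner G (w - z))
          + s\<^sup>2 * (\<kappa> / 2 * (norm (M *v (w - z)))\<^sup>2 + \<rho> / 2 * (norm (w - z))\<^sup>2)"
        using cv unfolding expand by (simp add: algebra_simps)
    qed
    then have "ereal (real_of_ereal (F z)) + ereal (inner (- G) (w - z)) \<le> ereal (real_of_ereal (F w))"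
      by simp
    then show ?thesis
      using effdom_imp_real[OF F(1) z] effdom_imp_real[OF F(1) w] by simp
  qed
  then show ?thesis using z by (simp add: subdifferential_def G_def)
qed

section \<open>One accelerated step for a single block\<close>

text \<open>The points \<open>x'\<close> and \<open>xbar\<close> average \<open>u'\<close> and
  \<open>u\<close> with \<open>x\<close> using the same weights, so they differ by
  \<open>(u' - u) / T\<close>; after scaling by \<open>T\<close>, the descent lemma costs only
  \<open>C / (2 * T)\<close> times the squared step. Convexity of \<open>h1\<close>, its subgradient
  at \<open>u'\<close> and the gradient of \<open>h2\<close> at \<open>xbar\<close> supply the rest,
  and \<open>\<zeta>\<close> collects the other terms of the optimality condition.\<close>

lemma accelerated_composite_step:
  fixes h1 :: "'a::real_inner \<Rightarrow> ereal" and h2 :: "'a \<Rightarrow> real" and dh2 :: "'a \<Rightarrow> 'a"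
  assumes h1: "proper_fun h1" "strongly_convex_fun \<mu> h1"
    and h2: "convex_on UNIV h2" "\<And>z. GDERIV h2 z :> dh2 z" "C-lipschitz_on UNIV dh2"
    and T: "1 \<le> T"
    and xbar: "xbar = (1 / T) *\<^sub>R u + ((T - 1) / T) *\<^sub>R x"
    and x': "x' = (1 / T) *\<^sub>R u' + ((T - 1) / T) *\<^sub>R x"
    and sub: "- (dh2 xbar + \<zeta>) \<in> subdifferential h1 u'"
    and dom: "x \<in> effdom h1" "w \<in> effdom h1"
  shows "x' \<in> effdom h1"
    and "T * (real_of_ereal (h1 x') + h2 x') \<le> (T - 1) * (real_of_ereal (h1 x) + h2 x)
      + (real_of_ereal (h1 w) + h2 w) - inner \<zeta> (u' - w)
      + C / (2 * T) * (norm (u' - u))\<^sup>2 - \<mu> / 2 * (norm (u' - w))\<^sup>2"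
proof -
  have cvx: "convex_fun h1" using h1(2) by (simp add: strongly_convex_fun_def)
  have u': "u' \<in> effdom h1" using sub by (simp add: subdifferential_def)
  have wts: "0 \<le> 1 / T" "0 \<le> (T - 1) / T" "1 / T + (T - 1) / T = 1"
    using T by (auto simp: field_simps)
  show "x' \<in> effdom h1"
    unfolding x' by (rule convex_combination_effdom[OF h1(1) cvx u' dom(1) wts])
  have "real_of_ereal (h1 x') \<le> 1 / T * real_of_ereal (h1 u') + (T - 1) / T * real_of_ereal (h1 x)"
    unfolding x' by (rule convex_combination_effdom[OF h1(1) cvx u' dom(1) wts])
  then have "T * real_of_ereal (h1 x')
      \<le> T * (1 / T * real_of_ereal (h1 u') + (T - 1) / T * real_of_ereal (h1 x))"
    using T by (intro mult_left_mono) auto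
  also have "\<dots> = real_of_ereal (h1 u') + (T - 1) * real_of_ereal (h1 x)"
    using T by (simp add: distrib_left)
  finally have 1: "T * real_of_ereal (h1 x') \<le> real_of_ereal (h1 u') + (T - 1) * real_of_ereal (h1 x)" .
  have "ereal (\<mu> / 2 * (norm (w - u'))\<^sup>2)
      \<le> h1 w - h1 u' - ereal (inner (- (dh2 xbar + \<zeta>)) (w - u'))"
    using h1(2) sub unfolding strongly_convex_fun_def by blast
  also have "\<dots> = ereal (real_of_ereal (h1 w) - real_of_ereal (h1 u')
      - inner (- (dh2 xbar + \<zeta>)) (w - u'))"
    using effdom_imp_real[OF h1(1) dom(2)] effdom_imp_real[OF h1(1) u']
    by (metis ereal_minus(1))
  finally have 2: "real_of_ereal (h1 u') \<le> real_of_ereal (h1 w) + inner (dh2 xbar + \<zeta>) (w - u')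
      - \<mu> / 2 * (norm (u' - w))\<^sup>2"
    unfolding norm_minus_commute[of w] inner_minus_left ereal_less_eq(3) by linarith
  have diff: "x' - xbar = (1 / T) *\<^sub>R (u' - u)"
    unfolding x' xbar by (simp add: algebra_simps)
  have "h2 x' \<le> h2 xbar + inner (dh2 xbar) (x' - xbar) + C / 2 * (norm (x' - xbar))\<^sup>2"
    by (rule lipschitz_gradient_descent[OF h2(2,3)])
  then have "T * h2 x' \<le> T * (h2 xbar + inner (dh2 xbar) (x' - xbar) + C / 2 * (norm (x' - xbar))\<^sup>2)"
    using T by (intro mult_left_mono) auto
  also have "T * (C / 2 * (norm (x' - xbar))\<^sup>2) = C / (2 * T) * (norm (u' - u))\<^sup>2"
    using T unfolding diff norm_scaleR power_mult_distrib by (simp add: field_simps power2_eq_square)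
  then have "T * (h2 xbar + inner (dh2 xbar) (x' - xbar) + C / 2 * (norm (x' - xbar))\<^sup>2)
      = T * h2 xbar + inner (dh2 xbar) (T *\<^sub>R (x' - xbar)) + C / (2 * T) * (norm (u' - u))\<^sup>2"
    by (simp add: distrib_left)
  \<comment> \<open>The splitting is chosen so that the first part cancels the gradient in the
    subgradient inequality, while the other two enter the gradient inequalities at \<open>w\<close>
    and \<open>x\<close>.\<close>
  also have "T *\<^sub>R (x' - xbar) = (u' - w) + (w - xbar) + (T - 1) *\<^sub>R (x - xbar)"
  proof -
    have "T *\<^sub>R x' = u' + (T - 1) *\<^sub>R x" using T by (simp add: x' scaleR_add_right)
    then show ?thesis by (simp add: algebra_simps)
  qed
  also have "inner (dh2 xbar) \<dots> = inner (dh2 xbar) (u' - w) + inner (dh2 xbar) (w - xbar)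
      + (T - 1) * inner (dh2 xbar) (x - xbar)"
    by (simp only: inner_add_right inner_scaleR_right)
  finally have 3: "T * h2 x' \<le> T * h2 xbar + (inner (dh2 xbar) (u' - w) + inner (dh2 xbar) (w - xbar)
      + (T - 1) * inner (dh2 xbar) (x - xbar)) + C / (2 * T) * (norm (u' - u))\<^sup>2" .
  have 4: "h2 xbar + inner (dh2 xbar) (w - xbar) \<le> h2 w"
    by (rule convex_above_gradient[OF h2(1,2)])
  have "(T - 1) * (h2 xbar + inner (dh2 xbar) (x - xbar)) \<le> (T - 1) * h2 x"
    using T by (intro mult_left_mono convex_above_gradient[OF h2(1,2)]) auto
  then have 5: "T * h2 xbar - h2 xbar + (T - 1) * inner (dh2 xbar) (x - xbar) \<le> (T - 1) * h2 x"
    by (simp add: algebra_simps)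
  have 6: "inner (dh2 xbar + \<zeta>) (w - u') = - inner (dh2 xbar) (u' - w) - inner \<zeta> (u' - w)"
    by (simp add: inner_add_left inner_diff_right)
  show "T * (real_of_ereal (h1 x') + h2 x') \<le> (T - 1) * (real_of_ereal (h1 x) + h2 x)
      + (real_of_ereal (h1 w) + h2 w) - inner \<zeta> (u' - w)
      + C / (2 * T) * (norm (u' - u))\<^sup>2 - \<mu> / 2 * (norm (u' - w))\<^sup>2"
    using 1 2 3 4 5 unfolding 6 distrib_left by linarith
qed

section \<open>Decrease of the energy\<close>

text \<open>Turns the proximal and multiplier inner products into differences of squares that
  telescope.\<close>

lemma inner_diff_self_eq:
  fixes a c :: "'a::real_inner"
  shows "inner (a - c) a = ((norm a)\<^sup>2 + (norm (a - c))\<^sup>2 - (norm c)\<^sup>2) / 2"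
  by (simp add: power2_norm_eq_inner inner_diff_left inner_diff_right inner_commute)

text \<open>In the application \<open>p\<close>, \<open>q\<close> and \<open>l\<close> are
  deviations from the saddle point, with \<open>a\<close> and \<open>c\<close> the images of
  \<open>p\<close> and \<open>q\<close> under \<open>A\<close> and \<open>B\<close>. After
  multiplying by \<open>T\<close>, each inner product is polarised; the leftover squares of
  \<open>p - p0\<close> and \<open>q - q0\<close> dominate the curvature terms by the bounds on
  \<open>Cf\<close> and \<open>Cg\<close>.\<close>

lemma energy_step:
  fixes p p0 :: "'a::real_inner" and q q0 :: "'b::real_inner" and l l0 a c c0 :: "'c::real_inner"
  assumes pos: "0 < \<alpha>" "0 < \<beta>" "0 < \<gamma>" "0 < T"
    and Cf: "\<alpha> * Cf \<le> 1" and Cg: "\<beta> * Cg \<le> T\<^sup>2"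
    and l: "l = l0 + (\<gamma> * T) *\<^sub>R (a + c)"
    and step: "T * h - (T - 1) * h0 \<le> - inner l (a + c) + \<gamma> * T * inner (c - c0) a
        - 1 / (\<alpha> * T) * inner (p - p0) p - T / \<beta> * inner (q - q0) q
        + Cf / (2 * T) * (norm (p - p0))\<^sup>2 + Cg / (2 * T) * (norm (q - q0))\<^sup>2 - \<mu> / 2 * (norm q)\<^sup>2"
  shows "T\<^sup>2 * h + 1 / (2 * \<alpha>) * (norm p)\<^sup>2 + T\<^sup>2 / (2 * \<beta>) * (norm q)\<^sup>2
      + 1 / (2 * \<gamma>) * (norm l)\<^sup>2 + \<gamma> * T\<^sup>2 / 2 * (norm c)\<^sup>2 + \<mu> * T / 2 * (norm q)\<^sup>2
    \<le> T * (T - 1) * h0 + 1 / (2 * \<alpha>) * (norm p0)\<^sup>2 + T\<^sup>2 / (2 * \<beta>) * (norm q0)\<^sup>2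
      + 1 / (2 * \<gamma>) * (norm l0)\<^sup>2 + \<gamma> * T\<^sup>2 / 2 * (norm c0)\<^sup>2"
proof -
  define r where "r = a + c"
  have lr: "l - l0 = (\<gamma> * T) *\<^sub>R r" by (simp add: l r_def)
  have "\<gamma> * T * inner l r = inner (l - l0) l"
    by (simp add: lr inner_commute)
  then have "\<gamma> * T * inner l r = ((norm l)\<^sup>2 + (\<gamma> * T)\<^sup>2 * (norm r)\<^sup>2 - (norm l0)\<^sup>2) / 2"
    unfolding inner_diff_self_eq[of l l0] by (simp add: lr power_mult_distrib)
  then have L: "T * inner l r = 1 / (2 * \<gamma>) * (norm l)\<^sup>2 - 1 / (2 * \<gamma>) * (norm l0)\<^sup>2
      + \<gamma> * T\<^sup>2 / 2 * (norm r)\<^sup>2"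
    using pos by (simp add: field_simps power2_eq_square)
  have P: "inner (p - p0) p = ((norm p)\<^sup>2 + (norm (p - p0))\<^sup>2 - (norm p0)\<^sup>2) / 2"
    and Q: "inner (q - q0) q = ((norm q)\<^sup>2 + (norm (q - q0))\<^sup>2 - (norm q0)\<^sup>2) / 2"
    and C: "inner (c - c0) c = ((norm c)\<^sup>2 + (norm (c - c0))\<^sup>2 - (norm c0)\<^sup>2) / 2"
    by (rule inner_diff_self_eq)+
  \<comment> \<open>Young's inequality with equal weights: the square of \<open>r\<close> it
    produces is exactly the one released by the multiplier update in \<open>L\<close>, so no upper
    bound on \<open>\<gamma>\<close> arises.\<close>
  have "0 \<le> (norm (r - (c - c0)))\<^sup>2" by simp
  then have "2 * inner (c - c0) r \<le> (norm r)\<^sup>2 + (norm (c - c0))\<^sup>2"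
    by (simp add: power2_norm_eq_inner inner_diff_left inner_diff_right inner_commute)
  moreover have "inner (c - c0) a = inner (c - c0) r - inner (c - c0) c"
    by (simp add: r_def inner_add_right)
  ultimately have "inner (c - c0) a \<le> ((norm r)\<^sup>2 - (norm c)\<^sup>2 + (norm c0)\<^sup>2) / 2"
    using C by (simp only:) argo
  then have A: "\<gamma> * T\<^sup>2 * inner (c - c0) a \<le> \<gamma> * T\<^sup>2 * (((norm r)\<^sup>2 - (norm c)\<^sup>2 + (norm c0)\<^sup>2) / 2)"
    using pos by (intro mult_left_mono) auto
  have "Cf \<le> 1 / \<alpha>" "Cg \<le> T\<^sup>2 / \<beta>" using Cf Cg pos by (auto simp: field_simps)
  then have D: "Cf * (norm (p - p0))\<^sup>2 \<le> 1 / \<alpha> * (norm (p - p0))\<^sup>2"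
    "Cg * (norm (q - q0))\<^sup>2 \<le> T\<^sup>2 / \<beta> * (norm (q - q0))\<^sup>2"
    by (simp_all only: mult_right_mono zero_le_power2)
  have "T * (T * h - (T - 1) * h0) \<le> T * (- inner l (a + c) + \<gamma> * T * inner (c - c0) a
        - 1 / (\<alpha> * T) * inner (p - p0) p - T / \<beta> * inner (q - q0) q
        + Cf / (2 * T) * (norm (p - p0))\<^sup>2 + Cg / (2 * T) * (norm (q - q0))\<^sup>2 - \<mu> / 2 * (norm q)\<^sup>2)"
    using step pos by (intro mult_left_mono) auto
  also have "\<dots> = - (T * inner l r) + \<gamma> * T\<^sup>2 * inner (c - c0) a - 1 / \<alpha> * inner (p - p0) p
      - T\<^sup>2 / \<beta> * inner (q - q0) q + Cf * (norm (p - p0))\<^sup>2 / 2 + Cg * (norm (q - q0))\<^sup>2 / 2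
      - \<mu> * T / 2 * (norm q)\<^sup>2"
    using pos unfolding r_def[symmetric] by (simp add: field_simps power2_eq_square)
  finally have "T\<^sup>2 * h - T * (T - 1) * h0 \<le> - (T * inner l r) + \<gamma> * T\<^sup>2 * inner (c - c0) a
      - 1 / \<alpha> * inner (p - p0) p
      - T\<^sup>2 / \<beta> * inner (q - q0) q + Cf * (norm (p - p0))\<^sup>2 / 2 + Cg * (norm (q - q0))\<^sup>2 / 2
      - \<mu> * T / 2 * (norm q)\<^sup>2"
    by (simp add: algebra_simps power2_eq_square)
  moreover have "1 / \<alpha> * inner (p - p0) p = 1 / (2 * \<alpha>) * (norm p)\<^sup>2
      + 1 / \<alpha> * (norm (p - p0))\<^sup>2 / 2 - 1 / (2 * \<alpha>) * (norm p0)\<^sup>2"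
    unfolding P using pos by (simp add: field_simps)
  moreover have "T\<^sup>2 / \<beta> * inner (q - q0) q = T\<^sup>2 / (2 * \<beta>) * (norm q)\<^sup>2
      + T\<^sup>2 / \<beta> * (norm (q - q0))\<^sup>2 / 2 - T\<^sup>2 / (2 * \<beta>) * (norm q0)\<^sup>2"
    unfolding Q using pos by (simp add: field_simps)
  moreover have "\<gamma> * T\<^sup>2 * inner (c - c0) a \<le> \<gamma> * T\<^sup>2 / 2 * (norm r)\<^sup>2
      - \<gamma> * T\<^sup>2 / 2 * (norm c)\<^sup>2 + \<gamma> * T\<^sup>2 / 2 * (norm c0)\<^sup>2"
    using A by (simp add: algebra_simps add_divide_distrib diff_divide_distrib)
  ultimately show ?thesis using L D by argo
qed

text \<open>By the operator norm, the two weighted squares together are at most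
  \<open>(1 + \<beta> * \<gamma> * N\<^sup>2) / (2 * \<beta>)\<close> times the squared norm of
  \<open>q\<close>. The growth allowed for the squared \<open>t\<close> has exactly this factor in
  its denominator, leaving \<open>\<mu> * T / 2\<close>.\<close>

lemma strong_convexity_absorbs_growth:
  fixes B :: "real^'n^'p"
  assumes pos: "0 < \<beta>" "0 < \<gamma>"
    and T: "T'\<^sup>2 \<le> T\<^sup>2 + \<beta> * \<mu> / (1 + \<beta> * \<gamma> * (onorm (\<lambda>z. B *v z))\<^sup>2) * T"
    and mono: "T\<^sup>2 \<le> T'\<^sup>2"
  shows "T'\<^sup>2 / (2 * \<beta>) * (norm q)\<^sup>2 + \<gamma> * T'\<^sup>2 / 2 * (norm (B *v q))\<^sup>2
    \<le> T\<^sup>2 / (2 * \<beta>) * (norm q)\<^sup>2 + \<gamma> * T\<^sup>2 / 2 * (norm (B *v q))\<^sup>2 + \<mu> * T / 2 * (norm q)\<^sup>2"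
proof -
  define N where "N = onorm (\<lambda>z. B *v z)"
  define K where "K = 1 + \<beta> * \<gamma> * N\<^sup>2"
  have "norm (B *v q) \<le> N * norm q"
    unfolding N_def by (intro onorm matrix_vector_mul_bounded_linear)
  then have "(norm (B *v q))\<^sup>2 \<le> N\<^sup>2 * (norm q)\<^sup>2"
    using power_mono[of "norm (B *v q)" "N * norm q" 2] by (simp add: power_mult_distrib)
  then have "\<beta> * \<gamma> * (norm (B *v q))\<^sup>2 \<le> \<beta> * \<gamma> * (N\<^sup>2 * (norm q)\<^sup>2)"
    using pos by (intro mult_left_mono) auto
  then have 1: "(norm q)\<^sup>2 + \<beta> * \<gamma> * (norm (B *v q))\<^sup>2 \<le> K * (norm q)\<^sup>2"
    by (simp add: K_def algebra_simps)
  have K: "0 < K" using pos by (auto simp: K_def intro!: add_pos_nonneg)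
  have "(T'\<^sup>2 - T\<^sup>2) * ((norm q)\<^sup>2 + \<beta> * \<gamma> * (norm (B *v q))\<^sup>2) \<le> (T'\<^sup>2 - T\<^sup>2) * (K * (norm q)\<^sup>2)"
    using 1 mono by (intro mult_left_mono) auto
  also have "\<dots> \<le> (\<beta> * \<mu> / K * T) * (K * (norm q)\<^sup>2)"
    using T K by (intro mult_right_mono) (auto simp: K_def N_def)
  also have "\<dots> = \<beta> * \<mu> * T * (norm q)\<^sup>2" using K by simp
  finally have "(T'\<^sup>2 - T\<^sup>2) * ((norm q)\<^sup>2 + \<beta> * \<gamma> * (norm (B *v q))\<^sup>2) / (2 * \<beta>)
      \<le> \<beta> * \<mu> * T * (norm q)\<^sup>2 / (2 * \<beta>)"
    using pos by (intro divide_right_mono) auto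
  moreover have "(T'\<^sup>2 - T\<^sup>2) * ((norm q)\<^sup>2 + \<beta> * \<gamma> * (norm (B *v q))\<^sup>2) / (2 * \<beta>)
      = T'\<^sup>2 / (2 * \<beta>) * (norm q)\<^sup>2 + \<gamma> * T'\<^sup>2 / 2 * (norm (B *v q))\<^sup>2
        - (T\<^sup>2 / (2 * \<beta>) * (norm q)\<^sup>2 + \<gamma> * T\<^sup>2 / 2 * (norm (B *v q))\<^sup>2)"
    using pos by (simp add: field_simps)
  moreover have "\<beta> * \<mu> * T * (norm q)\<^sup>2 / (2 * \<beta>) = \<mu> * T / 2 * (norm q)\<^sup>2"
    using pos by simp
  ultimately show ?thesis by linarith
qed

section \<open>Averaging argument for the residuals\<close>

text \<open>The differences \<open>c - a\<close> stay in the ball of radius \<open>C\<close>, because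
  \<open>c (Suc k) - a (Suc k)\<close> is a convex combination of \<open>c k\<close> and \<open>c k - a k\<close>.\<close>

lemma norm_le_double_of_averaged_increments:
  fixes a c :: "nat \<Rightarrow> 'a::real_normed_vector"
  assumes c: "\<And>k. 1 \<le> k \<Longrightarrow> norm (c k) \<le> C" and start: "c 1 = a 1"
    and w: "\<And>k. 1 \<le> k \<Longrightarrow> 0 \<le> \<omega> k \<and> \<omega> k \<le> 1"
    and step: "\<And>k. 1 \<le> k \<Longrightarrow> a (Suc k) - \<omega> k *\<^sub>R a k = c (Suc k) - c k"
    and k: "1 \<le> k"
  shows "norm (a k) \<le> 2 * C"
proof -
  have "norm (c k - a k) \<le> C"
    using k
  proof (induction k rule: dec_induct)
    case base
    show ?case using c[of 1] start order_trans[OF norm_ge_zero c[of 1]] by simp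
  next
    case (step k)
    have "c (Suc k) - a (Suc k) = (1 - \<omega> k) *\<^sub>R c k + \<omega> k *\<^sub>R (c k - a k)"
      using assms(4)[of k] step.hyps by (simp add: algebra_simps)
    also have "norm \<dots> \<le> (1 - \<omega> k) * norm (c k) + \<omega> k * norm (c k - a k)"
      using w[of k] step.hyps by (intro norm_triangle_le add_mono) auto
    also have "\<dots> \<le> (1 - \<omega> k) * C + \<omega> k * C"
      using w[of k] step.hyps step.IH c[of k] by (intro add_mono mult_left_mono) auto
    finally show ?case by (simp add: algebra_simps)
  qed
  moreover have "norm (a k) \<le> norm (c k) + norm (c k - a k)"
    by (metis add_diff_cancel_left' diff_diff_eq2 norm_triangle_ineq4)
  ultimately show ?thesis using c[OF k] by linarith
qed

section \<open>Extrapolated points and feasibility of saddle points\<close>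

text \<open>With \<open>c\<close> the iterate before \<open>a\<close> and \<open>\<tau>\<close> its
  parameter, the vector weighted by \<open>1 / T\<close> is the current \<open>u\<close> or
  \<open>v\<close>. Thus the extrapolated point gets the form that
  \<open>accelerated_composite_step\<close> expects of \<open>xbar\<close>.\<close>

lemma extrapolation_eq:
  fixes a c :: "'a::real_vector"
  assumes "T \<noteq> 0"
  shows "a + ((\<tau> - 1) / T) *\<^sub>R (a - c)
    = (1 / T) *\<^sub>R (\<tau> *\<^sub>R a - (\<tau> - 1) *\<^sub>R c) + ((T - 1) / T) *\<^sub>R a"
proof -
  have "T *\<^sub>R (a + ((\<tau> - 1) / T) *\<^sub>R (a - c))
      = T *\<^sub>R ((1 / T) *\<^sub>R (\<tau> *\<^sub>R a - (\<tau> - 1) *\<^sub>R c) + ((T - 1) / T) *\<^sub>R a)"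
    using assms by (simp add: scaleR_add_right) (simp add: algebra_simps)
  then show ?thesis using assms by simp
qed

text \<open>Comparison with the finite point \<open>(a, c)\<close> makes the saddle value finite.
  Testing the multiplier \<open>ls + r\<close>, with \<open>r\<close> the residual, then forces the
  squared norm of \<open>r\<close> to be at most 0.\<close>

lemma saddle_point_feasible:
  assumes f: "\<And>z. f z \<noteq> -\<infinity>" and g: "\<And>z. g z \<noteq> -\<infinity>"
    and dom: "a \<in> effdom f" "c \<in> effdom g"
    and saddle: "(xs, ys, ls) \<in> saddle_points (lagrangian f g A B b)"
  shows "xs \<in> effdom f" "ys \<in> effdom g" "A *v xs + B *v ys = b"
proof -
  have le: "lagrangian f g A B b xs ys l \<le> lagrangian f g A B b xs ys ls"
    "lagrangian f g A B b xs ys ls \<le> lagrangian f g A B b x y ls" for l x y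
    using saddle by (auto simp: saddle_points_def)
  have "lagrangian f g A B b a c ls < \<infinity>"
    using dom by (auto simp: lagrangian_def effdom_def)
  with le(2)[of a c] have fin: "lagrangian f g A B b xs ys ls < \<infinity>" by (rule le_less_trans)
  then show dx: "xs \<in> effdom f" and dy: "ys \<in> effdom g"
    using f[of xs] g[of ys] by (auto simp: lagrangian_def effdom_def)
  define r where "r = A *v xs + B *v ys - b"
  have "inner r r \<le> 0"
    using le(1)[of "ls + r"] dx dy f[of xs] g[of ys]
    unfolding lagrangian_def r_def[symmetric] effdom_def
    by (cases "f xs"; cases "g ys") (auto simp: inner_add_left)
  then show "A *v xs + B *v ys = b" by (simp add: r_def not_less inner_gt_zero_iff flip: not_less)
qed

theorem theorem5:
  fixes f f1 :: "real^'m \<Rightarrow> ereal" and f2 :: "real^'m \<Rightarrow> real"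
    and df2 :: "real^'m \<Rightarrow> real^'m"
    and g g1 :: "real^'n \<Rightarrow> ereal" and g2 :: "real^'n \<Rightarrow> real"
    and dg2 :: "real^'n \<Rightarrow> real^'n"
    and A :: "real^'m^'p" and B :: "real^'n^'p" and b :: "real^'p"
    and L :: "real^'m \<Rightarrow> real^'n \<Rightarrow> real^'p \<Rightarrow> ereal"
    and Lf2 Lg2 \<mu>g \<alpha> \<beta> \<gamma> :: real
    and t :: "nat \<Rightarrow> real"
    and x u :: "nat \<Rightarrow> real^'m" and y v :: "nat \<Rightarrow> real^'n" and lam :: "nat \<Rightarrow> real^'p"
    and xs :: "real^'m" and ys :: "real^'n" and ls :: "real^'p"
    and E1 C1 :: real
  assumes f: "f = (\<lambda>z. f1 z + ereal (f2 z))"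
    and f1: "proper_fun f1" "closed_fun f1" "convex_fun f1"
    and f2: "convex_on UNIV f2" "\<And>z. GDERIV f2 z :> df2 z" "Lf2-lipschitz_on UNIV df2"
    and g: "g = (\<lambda>z. g1 z + ereal (g2 z))"
    and g1: "proper_fun g1" "closed_fun g1" "0 < \<mu>g" "strongly_convex_fun \<mu>g g1"
    and g2: "convex_on UNIV g2" "\<And>z. GDERIV g2 z :> dg2 z" "Lg2-lipschitz_on UNIV dg2"
    and L: "L = lagrangian f g A B b"
    and saddle: "(xs, ys, ls) \<in> saddle_points L"
    and params: "0 < \<alpha>" "0 < \<beta>" "0 < \<gamma>"
    and alg: "accelerated_linearized_admm f1 df2 g1 dg2 A B b \<alpha> \<beta> \<gamma> t x y u v lam"
    and step_\<alpha>: "ereal \<alpha> \<le> 1 / ereal Lf2"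
    and step_\<beta>: "ereal \<beta> \<le> ereal ((t 1)\<^sup>2) / ereal Lg2"
    and t_ge1: "\<And>k. 1 \<le> k \<Longrightarrow> 1 \<le> t k"
    and t_mono: "mono_on {1..} t"
    and t_step1: "\<And>k. 1 \<le> k \<Longrightarrow> (t (k + 1))\<^sup>2 \<le> (t k)\<^sup>2 + t (k + 1)"
    and t_step2: "\<And>k. 1 \<le> k \<Longrightarrow> (t (k + 1))\<^sup>2
          \<le> (t k)\<^sup>2 + \<beta> * \<mu>g / (1 + \<beta> * \<gamma> * (onorm (\<lambda>z. B *v z))\<^sup>2) * t k"
    and E1: "E1 = (t 1)\<^sup>2 * real_of_ereal (L (x 1) (y 1) ls - L xs ys ls)
          + 1 / (2 * \<alpha>) * (norm (x 1 - xs))\<^sup>2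
          + (t 2)\<^sup>2 / (2 * \<beta>) * (norm (y 1 - ys))\<^sup>2
          + 1 / (2 * \<gamma>) * (norm (lam 1 - ls))\<^sup>2"
    and C1: "C1 = 3 * (t 1)\<^sup>2 * norm (A *v x 1 + B *v y 1 - b)
          + (2 * norm (lam 1 - ls)
             + 2 * sqrt (2 * \<gamma> * E1 + \<gamma>\<^sup>2 * (t 2)\<^sup>2 * (norm (B *v (y 1 - ys)))\<^sup>2)) / \<gamma>"
  shows "\<forall>k\<ge>1.
      L (x k) (y k) ls - L xs ys ls
        \<le> ereal ((E1 + \<gamma> * (t 2)\<^sup>2 / 2 * (norm (B *v (y 1 - ys)))\<^sup>2) / (t k)\<^sup>2) \<and>
      norm (A *v x k + B *v y k - b) \<le> C1 / (t k)\<^sup>2 \<and>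
      \<bar>f (x k) + g (y k) - f xs - g ys\<bar>
        \<le> ereal ((E1 + \<gamma> * (t 2)\<^sup>2 / 2 * (norm (B *v (y 1 - ys)))\<^sup>2 + C1 * norm ls)
                  / (t k)\<^sup>2)"
proof -
  define rf where "rf z = real_of_ereal (f1 z) + f2 z" for z
  define rg where "rg z = real_of_ereal (g1 z) + g2 z" for z
  have cvx_g1: "convex_fun g1" using g1(4) by (simp add: strongly_convex_fun_def)
  have f_real: "f z = ereal (rf z)" if "z \<in> effdom f1" for z
    unfolding f rf_def using effdom_imp_real[OF f1(1) that] by (metis plus_ereal.simps(1))
  have g_real: "g z = ereal (rg z)" if "z \<in> effdom g1" for z
    unfolding g rg_def using effdom_imp_real[OF g1(1) that] by (metis plus_ereal.simps(1))
  have dom_f: "effdom f = effdom f1" and dom_g: "effdom g = effdom g1"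
    by (auto simp: f g effdom_def)
  have proper: "f z \<noteq> -\<infinity>" "g z' \<noteq> -\<infinity>" for z z'
    using f1(1) g1(1) by (auto simp: f g proper_fun_def)
  have init: "x 1 = x 0" "u 1 = x 1" "x 1 \<in> effdom f1" "y 1 = y 0" "v 1 = y 1" "y 1 \<in> effdom g1"
    using alg unfolding accelerated_linearized_admm_def by auto
  have opt: "xs \<in> effdom f1" "ys \<in> effdom g1" and feas: "A *v xs + B *v ys = b"
    using saddle_point_feasible[of f g "x 1" "y 1" xs ys ls A B b, OF proper,
        unfolded dom_f dom_g, OF init(3,6) saddle[unfolded L]] by auto
  have Lf: "0 \<le> Lf2" and Lg: "0 \<le> Lg2"
    using f2(3) g2(3) by (auto simp: lipschitz_on_def)
  \<comment> \<open>For a zero Lipschitz constant the \<open>ereal\<close> quotient is infinite and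
    the product form is trivial; this is the reading of 1/0 in the step-size bounds.\<close>
  have "\<alpha> * Lf2 \<le> 1"
    using step_\<alpha> Lf by (cases "Lf2 = 0") (auto simp: one_ereal_def field_simps)
  have "\<beta> * Lg2 \<le> (t 1)\<^sup>2"
    using step_\<beta> Lg by (cases "Lg2 = 0") (auto simp: field_simps)

  \<comment> \<open>Iterates in averaged form and their optimality conditions\<close>
  define \<xi>x where "\<xi>x k = x k + ((t k - 1) / t (k + 1)) *\<^sub>R (x k - x (k - 1))" for k
  define \<xi>y where "\<xi>y k = y k + ((t k - 1) / t (k + 1)) *\<^sub>R (y k - y (k - 1))" for k
  note alg_iter = alg[unfolded accelerated_linearized_admm_def Let_def, folded \<xi>x_def \<xi>y_def,
        THEN conjunct2, THEN conjunct2, THEN conjunct2, THEN conjunct2, THEN conjunct2, THEN conjunct2,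
        THEN spec, THEN mp]
  have iter:
    "is_arg_min (\<lambda>w. f1 w + ereal (inner (transpose A *v lam k + df2 (\<xi>x k)) w
       + \<gamma> * t (k + 1) / 2 * (norm (A *v w + B *v v k - b))\<^sup>2
       + 1 / (2 * \<alpha> * t (k + 1)) * (norm (w - u k))\<^sup>2)) (\<lambda>_. True) (u (k + 1))"
    "is_arg_min (\<lambda>w. g1 w + ereal (inner (transpose B *v lam k + dg2 (\<xi>y k)) w
       + \<gamma> * t (k + 1) / 2 * (norm (A *v u (k + 1) + B *v w - b))\<^sup>2
       + t (k + 1) / (2 * \<beta>) * (norm (w - v k))\<^sup>2)) (\<lambda>_. True) (v (k + 1))"
    "x (k + 1) = (1 / t (k + 1)) *\<^sub>R u (k + 1) + ((t (k + 1) - 1) / t (k + 1)) *\<^sub>R x k"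
    "y (k + 1) = (1 / t (k + 1)) *\<^sub>R v (k + 1) + ((t (k + 1) - 1) / t (k + 1)) *\<^sub>R y k"
    "lam (k + 1) = lam k + (\<gamma> * t (k + 1)) *\<^sub>R (A *v u (k + 1) + B *v v (k + 1) - b)"
    if "1 \<le> k" for k
    by (rule alg_iter[OF that, THEN conjunct1] alg_iter[OF that, THEN conjunct2, THEN conjunct1]
        alg_iter[OF that, THEN conjunct2, THEN conjunct2, THEN conjunct1]
        alg_iter[OF that, THEN conjunct2, THEN conjunct2, THEN conjunct2, THEN conjunct1]
        alg_iter[OF that, THEN conjunct2, THEN conjunct2, THEN conjunct2, THEN conjunct2])+
  \<comment> \<open>At \<open>k = 1\<close> this holds for every value of \<open>t 1\<close>,
    because \<open>x 0 = x 1 = u 1\<close> and \<open>y 0 = y 1 = v 1\<close>.\<close>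
  have u_eq: "u k = t k *\<^sub>R x k - (t k - 1) *\<^sub>R x (k - 1)"
    and v_eq: "v k = t k *\<^sub>R y k - (t k - 1) *\<^sub>R y (k - 1)" if "1 \<le> k" for k
  proof -
    have "u k = t k *\<^sub>R x k - (t k - 1) *\<^sub>R x (k - 1) \<and>
      v k = t k *\<^sub>R y k - (t k - 1) *\<^sub>R y (k - 1)"
    proof (cases "k = 1")
      case True
      then show ?thesis using init by (simp add: algebra_simps)
    next
      case False
      define j where "j = k - 1"
      have j: "k = j + 1" "1 \<le> j" using that False by (auto simp: j_def)
      have "t (j + 1) > 0" using t_ge1[of "j + 1"] by simp
      then show ?thesis
        using iter(3,4)[OF j(2)] unfolding j(1) by (simp add: scaleR_add_right)
    qed
    then show "u k = t k *\<^sub>R x k - (t k - 1) *\<^sub>R x (k - 1)"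
      "v k = t k *\<^sub>R y k - (t k - 1) *\<^sub>R y (k - 1)" by auto
  qed
  have \<xi>x: "\<xi>x k = (1 / t (k + 1)) *\<^sub>R u k + ((t (k + 1) - 1) / t (k + 1)) *\<^sub>R x k"
    and \<xi>y: "\<xi>y k = (1 / t (k + 1)) *\<^sub>R v k + ((t (k + 1) - 1) / t (k + 1)) *\<^sub>R y k"
    if "1 \<le> k" for k
  proof -
    have nz: "t (k + 1) \<noteq> 0" using t_ge1[of "k + 1"] by simp
    show "\<xi>x k = (1 / t (k + 1)) *\<^sub>R u k + ((t (k + 1) - 1) / t (k + 1)) *\<^sub>R x k"
      unfolding \<xi>x_def u_eq[OF that] by (rule extrapolation_eq[OF nz])
    show "\<xi>y k = (1 / t (k + 1)) *\<^sub>R v k + ((t (k + 1) - 1) / t (k + 1)) *\<^sub>R y k"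
      unfolding \<xi>y_def v_eq[OF that] by (rule extrapolation_eq[OF nz])
  qed
  \<comment> \<open>The optimality conditions without the gradients of \<open>f2\<close> and
    \<open>g2\<close>. The penalty is regrouped around the active variable; \<open>\<zeta>x\<close>
    still contains the old \<open>v k\<close>, whereas \<open>\<zeta>y\<close> contains the new
    \<open>u (k + 1)\<close>.\<close>
  define \<zeta>x where "\<zeta>x k = transpose A *v lam k
      + (\<gamma> * t (k + 1)) *\<^sub>R (transpose A *v (A *v u (k + 1) - (b - B *v v k)))
      + (1 / (\<alpha> * t (k + 1))) *\<^sub>R (u (k + 1) - u k)" for k
  define \<zeta>y where "\<zeta>y k = transpose B *v lam k
      + (\<gamma> * t (k + 1)) *\<^sub>R (transpose B *v (B *v v (k + 1) - (b - A *v u (k + 1))))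
      + (t (k + 1) / \<beta>) *\<^sub>R (v (k + 1) - v k)" for k
  have sub_x: "- (df2 (\<xi>x k) + \<zeta>x k) \<in> subdifferential f1 (u (k + 1))" if "1 \<le> k" for k
  proof -
    have "A *v w + B *v v k - b = A *v w - (b - B *v v k)" for w by simp
    moreover have "1 / (2 * \<alpha> * t (k + 1)) = 1 / (\<alpha> * t (k + 1)) / 2" by simp
    ultimately have "is_arg_min (\<lambda>w. f1 w + ereal (inner (transpose A *v lam k + df2 (\<xi>x k)) w
       + \<gamma> * t (k + 1) / 2 * (norm (A *v w - (b - B *v v k)))\<^sup>2
       + 1 / (\<alpha> * t (k + 1)) / 2 * (norm (w - u k))\<^sup>2)) (\<lambda>_. True) (u (k + 1))"
      using iter(1)[OF that] by (simp only:)
    from arg_min_quadratic_subgradient[OF f1(1,3) this] show ?thesis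
      unfolding \<zeta>x_def by (simp only: ac_simps)
  qed
  have sub_y: "- (dg2 (\<xi>y k) + \<zeta>y k) \<in> subdifferential g1 (v (k + 1))" if "1 \<le> k" for k
  proof -
    have "A *v u (k + 1) + B *v w - b = B *v w - (b - A *v u (k + 1))" for w by simp
    moreover have "t (k + 1) / (2 * \<beta>) = t (k + 1) / \<beta> / 2" by simp
    ultimately have "is_arg_min (\<lambda>w. g1 w + ereal (inner (transpose B *v lam k + dg2 (\<xi>y k)) w
       + \<gamma> * t (k + 1) / 2 * (norm (B *v w - (b - A *v u (k + 1))))\<^sup>2
       + t (k + 1) / \<beta> / 2 * (norm (w - v k))\<^sup>2)) (\<lambda>_. True) (v (k + 1))"
      using iter(2)[OF that] by (simp only:)
    from arg_min_quadratic_subgradient[OF g1(1) cvx_g1 this] show ?thesis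
      unfolding \<zeta>y_def by (simp only: ac_simps)
  qed
  note f1_strong = proper_convex_imp_strongly_convex_zero[OF f1(1,3)]
  \<comment> \<open>Domain membership of the iterates stays a premise here, since the induction that
    proves it for all \<open>k\<close> uses the first of these facts.\<close>
  have block_x: "x k \<in> effdom f1 \<Longrightarrow> x (k + 1) \<in> effdom f1"
    "x k \<in> effdom f1 \<Longrightarrow> t (k + 1) * rf (x (k + 1)) \<le> (t (k + 1) - 1) * rf (x k) + rf xs
      - inner (\<zeta>x k) (u (k + 1) - xs) + Lf2 / (2 * t (k + 1)) * (norm (u (k + 1) - u k))\<^sup>2"
    if k: "1 \<le> k" for k
    using accelerated_composite_step[OF f1(1) f1_strong f2 t_ge1 \<xi>x[OF k] iter(3)[OF k] sub_x[OF k] _ opt(1)]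
    unfolding rf_def by simp_all
  have block_y: "y k \<in> effdom g1 \<Longrightarrow> y (k + 1) \<in> effdom g1"
    "y k \<in> effdom g1 \<Longrightarrow> t (k + 1) * rg (y (k + 1)) \<le> (t (k + 1) - 1) * rg (y k) + rg ys
      - inner (\<zeta>y k) (v (k + 1) - ys) + Lg2 / (2 * t (k + 1)) * (norm (v (k + 1) - v k))\<^sup>2
      - \<mu>g / 2 * (norm (v (k + 1) - ys))\<^sup>2"
    if k: "1 \<le> k" for k
    using accelerated_composite_step[OF g1(1,4) g2 t_ge1 \<xi>y[OF k] iter(4)[OF k] sub_y[OF k] _ opt(2)]
    unfolding rg_def by simp_all
  have dom: "x k \<in> effdom f1" "y k \<in> effdom g1" if "1 \<le> k" for k
  proof -
    from that have "x k \<in> effdom f1 \<and> y k \<in> effdom g1"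
      by (induction k rule: dec_induct) (use init block_x(1) block_y(1) in auto)
    then show "x k \<in> effdom f1" "y k \<in> effdom g1" by auto
  qed

  \<comment> \<open>Lagrangian gap, residuals and energy\<close>
  define s where "s k = A *v x k + B *v y k - b" for k
  define h where "h k = rf (x k) + rg (y k) + inner ls (s k) - (rf xs + rg ys)" for k
  have gap: "L (x k) (y k) ls - L xs ys ls = ereal (h k)" if "1 \<le> k" for k
    using dom[OF that] opt feas
    by (simp add: L lagrangian_def f_real g_real h_def s_def)
  have h_nonneg: "0 \<le> h k" if "1 \<le> k" for k
  proof -
    have "L xs ys ls \<le> L (x k) (y k) ls" using saddle by (auto simp: saddle_points_def)
    then show ?thesis
      using dom[OF that] opt feas
      by (simp add: L lagrangian_def f_real g_real h_def s_def)
  qed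
  have residual: "t (k + 1) *\<^sub>R s (k + 1) - (t (k + 1) - 1) *\<^sub>R s k
      = A *v (u (k + 1) - xs) + B *v (v (k + 1) - ys)"
    and residual_lam: "lam (k + 1) = lam k
      + (\<gamma> * t (k + 1)) *\<^sub>R (A *v (u (k + 1) - xs) + B *v (v (k + 1) - ys))"
    if k: "1 \<le> k" for k
  proof -
    have r: "A *v (u (k + 1) - xs) + B *v (v (k + 1) - ys) = A *v u (k + 1) + B *v v (k + 1) - b"
      using feas by (simp add: matrix_vector_mult_diff_distrib flip: feas)
    then show "lam (k + 1) = lam k
      + (\<gamma> * t (k + 1)) *\<^sub>R (A *v (u (k + 1) - xs) + B *v (v (k + 1) - ys))"
      using iter(5)[OF k] by simp
    have uv: "u (k + 1) = t (k + 1) *\<^sub>R x (k + 1) - (t (k + 1) - 1) *\<^sub>R x k"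
      "v (k + 1) = t (k + 1) *\<^sub>R y (k + 1) - (t (k + 1) - 1) *\<^sub>R y k"
      using u_eq[of "k + 1"] v_eq[of "k + 1"] by simp_all
    show "t (k + 1) *\<^sub>R s (k + 1) - (t (k + 1) - 1) *\<^sub>R s k
      = A *v (u (k + 1) - xs) + B *v (v (k + 1) - ys)"
      unfolding r s_def uv matrix_vector_mult_diff_distrib matrix_vector_mult_scaleR
      using feas by (simp add: algebra_simps)
  qed
  \<comment> \<open>The shifted index in the \<open>v\<close>-terms makes \<open>E k\<close> match
    the right side of \<open>energy_step\<close> with \<open>T = t (k + 1)\<close>. In
    \<open>E (k + 1)\<close> these terms carry \<open>t (k + 2)\<close>, which is where growth must
    be absorbed.\<close>
  define E where "E k = (t k)\<^sup>2 * h k + 1 / (2 * \<alpha>) * (norm (u k - xs))\<^sup>2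
      + (t (k + 1))\<^sup>2 / (2 * \<beta>) * (norm (v k - ys))\<^sup>2 + 1 / (2 * \<gamma>) * (norm (lam k - ls))\<^sup>2
      + \<gamma> * (t (k + 1))\<^sup>2 / 2 * (norm (B *v (v k - ys)))\<^sup>2" for k
  have t_le: "t i \<le> t j" if "1 \<le> i" "i \<le> j" for i j
    using t_mono that by (auto simp: mono_on_def)
  have E_dec: "E (k + 1) \<le> E k" if k: "1 \<le> k" for k
  proof -
    define T where "T = t (k + 1)"
    define p where "p = u (k + 1) - xs"
    define p0 where "p0 = u k - xs"
    define q where "q = v (k + 1) - ys"
    define q0 where "q0 = v k - ys"
    have T: "1 \<le> T" using t_ge1[of "k + 1"] by (simp add: T_def)
    have diffs: "u (k + 1) - u k = p - p0" "v (k + 1) - v k = q - q0"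
      by (simp_all add: p_def p0_def q_def q0_def)
    note lam = residual_lam[OF k, folded T_def p_def q_def]
    have "A *v u (k + 1) - (b - B *v v k) = A *v p + B *v q0"
      "B *v v (k + 1) - (b - A *v u (k + 1)) = A *v p + B *v q"
      by (simp_all add: p_def q_def q0_def matrix_vector_mult_diff_distrib flip: feas)
    then have \<zeta>: "\<zeta>x k = transpose A *v lam k + (\<gamma> * T) *\<^sub>R (transpose A *v (A *v p + B *v q0))
        + (1 / (\<alpha> * T)) *\<^sub>R (p - p0)"
      "\<zeta>y k = transpose B *v lam k + (\<gamma> * T) *\<^sub>R (transpose B *v (A *v p + B *v q))
        + (T / \<beta>) *\<^sub>R (q - q0)"
      unfolding \<zeta>x_def \<zeta>y_def diffs T_def by (simp_all only:)
    \<comment> \<open>The penalty gradient promotes \<open>lam k\<close> to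
      \<open>lam (k + 1)\<close>. For the \<open>v\<close>-block this is exact; for the
      \<open>u\<close>-block, which saw the old \<open>v k\<close>, the error involving
      \<open>B *v q - B *v q0\<close> remains.\<close>
    have \<zeta>p: "inner (\<zeta>x k) p = inner (lam (k + 1)) (A *v p) - \<gamma> * T * inner (B *v q - B *v q0) (A *v p)
        + 1 / (\<alpha> * T) * inner (p - p0) p"
      unfolding \<zeta> lam inner_add_left inner_scaleR_left inner_transpose_matrix_vector
      by (simp add: inner_diff_left algebra_simps)
    have \<zeta>q: "inner (\<zeta>y k) q = inner (lam (k + 1)) (B *v q) + T / \<beta> * inner (q - q0) q"
      unfolding \<zeta> lam inner_add_left inner_scaleR_left inner_transpose_matrix_vector ..
    have fx: "T * rf (x (k + 1)) \<le> (T - 1) * rf (x k) + rf xs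
        - inner (\<zeta>x k) p + Lf2 / (2 * T) * (norm (p - p0))\<^sup>2"
      using block_x(2)[OF k dom(1)[OF k]] unfolding diffs T_def p_def[symmetric] .
    have gy: "T * rg (y (k + 1)) \<le> (T - 1) * rg (y k) + rg ys
        - inner (\<zeta>y k) q + Lg2 / (2 * T) * (norm (q - q0))\<^sup>2 - \<mu>g / 2 * (norm q)\<^sup>2"
      using block_y(2)[OF k dom(2)[OF k]] unfolding diffs T_def q_def[symmetric] .
    have "inner ls (T *\<^sub>R s (k + 1) - (T - 1) *\<^sub>R s k) = inner ls (A *v p + B *v q)"
      using residual[OF k, folded T_def p_def q_def] by (simp only:)
    then have "T * inner ls (s (k + 1)) - (T - 1) * inner ls (s k)
        = inner ls (A *v p) + inner ls (B *v q)"
      by (simp only: inner_diff_right inner_add_right inner_scaleR_right)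
    moreover have "T * h (k + 1) - (T - 1) * h k = T * rf (x (k + 1)) - (T - 1) * rf (x k) - rf xs
        + (T * rg (y (k + 1)) - (T - 1) * rg (y k) - rg ys)
        + (T * inner ls (s (k + 1)) - (T - 1) * inner ls (s k))"
      unfolding h_def by (simp add: algebra_simps)
    moreover have "inner (lam (k + 1) - ls) (A *v p + B *v q) = inner (lam (k + 1)) (A *v p)
        + inner (lam (k + 1)) (B *v q) - (inner ls (A *v p) + inner ls (B *v q))"
      by (simp add: inner_diff_left inner_add_right)
    ultimately have step: "T * h (k + 1) - (T - 1) * h k
        \<le> - inner (lam (k + 1) - ls) (A *v p + B *v q)
        + \<gamma> * T * inner (B *v q - B *v q0) (A *v p)
        - 1 / (\<alpha> * T) * inner (p - p0) p - T / \<beta> * inner (q - q0) q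
        + Lf2 / (2 * T) * (norm (p - p0))\<^sup>2 + Lg2 / (2 * T) * (norm (q - q0))\<^sup>2
        - \<mu>g / 2 * (norm q)\<^sup>2"
      using fx gy unfolding \<zeta>p \<zeta>q by argo
    have lam': "lam (k + 1) - ls = (lam k - ls) + (\<gamma> * T) *\<^sub>R (A *v p + B *v q)"
      unfolding lam by simp
    have "t 1 \<le> T" "1 \<le> t 1" using t_le[of 1 "k + 1"] t_ge1[of 1] by (auto simp: T_def)
    then have "(t 1)\<^sup>2 \<le> T\<^sup>2" by (intro power_mono) auto
    then have "\<beta> * Lg2 \<le> T\<^sup>2" using \<open>\<beta> * Lg2 \<le> (t 1)\<^sup>2\<close> by simp
    from energy_step[OF params _ \<open>\<alpha> * Lf2 \<le> 1\<close> this lam' step] T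
    have en: "T\<^sup>2 * h (k + 1) + 1 / (2 * \<alpha>) * (norm p)\<^sup>2 + T\<^sup>2 / (2 * \<beta>) * (norm q)\<^sup>2
      + 1 / (2 * \<gamma>) * (norm (lam (k + 1) - ls))\<^sup>2 + \<gamma> * T\<^sup>2 / 2 * (norm (B *v q))\<^sup>2
      + \<mu>g * T / 2 * (norm q)\<^sup>2
      \<le> T * (T - 1) * h k + 1 / (2 * \<alpha>) * (norm p0)\<^sup>2 + T\<^sup>2 / (2 * \<beta>) * (norm q0)\<^sup>2
      + 1 / (2 * \<gamma>) * (norm (lam k - ls))\<^sup>2 + \<gamma> * T\<^sup>2 / 2 * (norm (B *v q0))\<^sup>2"
      by linarith
    define T' where "T' = t (k + 1 + 1)"
    have "T \<le> T'" using t_le[of "k + 1" "k + 1 + 1"] by (simp add: T_def T'_def)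
    then have "T\<^sup>2 \<le> T'\<^sup>2" using T by (intro power_mono) auto
    moreover have "T'\<^sup>2 \<le> T\<^sup>2 + \<beta> * \<mu>g / (1 + \<beta> * \<gamma> * (onorm (\<lambda>z. B *v z))\<^sup>2) * T"
      using t_step2[of "k + 1"] unfolding T_def T'_def by simp
    ultimately have growth: "T'\<^sup>2 / (2 * \<beta>) * (norm q)\<^sup>2 + \<gamma> * T'\<^sup>2 / 2 * (norm (B *v q))\<^sup>2
      \<le> T\<^sup>2 / (2 * \<beta>) * (norm q)\<^sup>2 + \<gamma> * T\<^sup>2 / 2 * (norm (B *v q))\<^sup>2 + \<mu>g * T / 2 * (norm q)\<^sup>2"
      using strong_convexity_absorbs_growth[OF params(2,3)] by blast
    \<comment> \<open>Together with nonnegativity of the gap, this replaces the weight of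
      \<open>h k\<close> in \<open>energy_step\<close> by the one in \<open>E k\<close>.\<close>
    have "T * (T - 1) \<le> (t k)\<^sup>2"
      using t_step1[OF k] unfolding T_def by (simp add: algebra_simps power2_eq_square)
    then have "T * (T - 1) * h k \<le> (t k)\<^sup>2 * h k"
      using h_nonneg[OF k] by (rule mult_right_mono)
    then show ?thesis
      using en growth unfolding E_def T_def[symmetric] T'_def[symmetric] p_def[symmetric]
        p0_def[symmetric] q_def[symmetric] q0_def[symmetric] by linarith
  qed

  \<comment> \<open>Bounds on the gap and the multipliers\<close>
  \<comment> \<open>This is the initial energy \<open>E 1\<close>; the constant \<open>E1\<close> of
    the statement lacks its last term, the one with \<open>B\<close>.\<close>
  define M where "M = E1 + \<gamma> * (t 2)\<^sup>2 / 2 * (norm (B *v (y 1 - ys)))\<^sup>2"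
  have "E 1 = M"
    using gap[of 1] unfolding E_def M_def E1 init by (simp add: numeral_2_eq_2)
  have E_le: "E k \<le> M" if "1 \<le> k" for k
    using that
  proof (induction k rule: dec_induct)
    case base
    then show ?case using \<open>E 1 = M\<close> by simp
  next
    case (step n)
    then show ?case using E_dec[of n] by simp
  qed
  have value_bound: "h k \<le> M / (t k)\<^sup>2"
    and dual_bound: "norm (lam k - ls) \<le> sqrt (2 * \<gamma> * M)" if k: "1 \<le> k" for k
  proof -
    have nonneg: "0 \<le> (t k)\<^sup>2 * h k" "0 \<le> 1 / (2 * \<alpha>) * (norm (u k - xs))\<^sup>2"
      "0 \<le> (t (k + 1))\<^sup>2 / (2 * \<beta>) * (norm (v k - ys))\<^sup>2"
      "0 \<le> 1 / (2 * \<gamma>) * (norm (lam k - ls))\<^sup>2"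
      "0 \<le> \<gamma> * (t (k + 1))\<^sup>2 / 2 * (norm (B *v (v k - ys)))\<^sup>2"
      using params h_nonneg[OF k] by simp_all
    then have "(t k)\<^sup>2 * h k \<le> M" using E_le[OF k] unfolding E_def by linarith
    then show "h k \<le> M / (t k)\<^sup>2"
      using t_ge1[OF k] by (simp add: field_simps)
    have "1 / (2 * \<gamma>) * (norm (lam k - ls))\<^sup>2 \<le> M"
      using nonneg E_le[OF k] unfolding E_def by linarith
    then have "(norm (lam k - ls))\<^sup>2 \<le> 2 * \<gamma> * M"
      using params by (simp add: field_simps)
    then show "norm (lam k - ls) \<le> sqrt (2 * \<gamma> * M)" by (rule real_le_rsqrt)
  qed
  define R where "R = sqrt (2 * \<gamma> * M)"
  have R: "R = sqrt (2 * \<gamma> * E1 + \<gamma>\<^sup>2 * (t 2)\<^sup>2 * (norm (B *v (y 1 - ys)))\<^sup>2)"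
    unfolding R_def M_def by (simp add: algebra_simps power2_eq_square)

  \<comment> \<open>Feasibility bound\<close>
  \<comment> \<open>The increments of \<open>c\<close> are those of the multipliers divided by
    \<open>\<gamma>\<close>; the shift by \<open>a 1\<close> provides the common start that the
    averaging lemma requires.\<close>
  define a where "a k = (t k)\<^sup>2 *\<^sub>R s k" for k
  define c where "c k = (1 / \<gamma>) *\<^sub>R (lam k - lam 1) + a 1" for k
  have feas_bound: "norm (s k) \<le> C1 / (t k)\<^sup>2" if k: "1 \<le> k" for k
  proof -
    have "norm (a k) \<le> 2 * (norm (a 1) + (norm (lam 1 - ls) + R) / \<gamma>)"
    proof (rule norm_le_double_of_averaged_increments
        \<comment> \<open>This weight makes \<open>\<omega> k *\<^sub>R a k\<close> equal to the old
          residual times \<open>t (k + 1) * (t (k + 1) - 1)\<close>; it is at most 1 by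
          \<open>t_step1\<close>.\<close>
        [where c = c and \<omega> = "\<lambda>k. t (k + 1) * (t (k + 1) - 1) / (t k)\<^sup>2"])
      fix k :: nat assume k: "1 \<le> k"
      have "norm (lam k - lam 1) \<le> norm (lam k - ls) + norm (lam 1 - ls)"
        using norm_triangle_ineq4[of "lam k - ls" "lam 1 - ls"] by simp
      then have "norm (lam k - lam 1) / \<gamma> \<le> (norm (lam 1 - ls) + R) / \<gamma>"
        using dual_bound[OF k] params unfolding R_def by (intro divide_right_mono) auto
      then show "norm (c k) \<le> norm (a 1) + (norm (lam 1 - ls) + R) / \<gamma>"
        unfolding c_def using params by (intro norm_triangle_le) simp
      have tk: "0 < t k" "1 \<le> t (k + 1)" using t_ge1[OF k] t_ge1[of "k + 1"] by auto
      then show "0 \<le> t (k + 1) * (t (k + 1) - 1) / (t k)\<^sup>2 \<and>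
          t (k + 1) * (t (k + 1) - 1) / (t k)\<^sup>2 \<le> 1"
        using t_step1[OF k] by (simp add: algebra_simps power2_eq_square)
      have "a (Suc k) - (t (k + 1) * (t (k + 1) - 1) / (t k)\<^sup>2) *\<^sub>R a k
          = t (k + 1) *\<^sub>R (t (k + 1) *\<^sub>R s (k + 1) - (t (k + 1) - 1) *\<^sub>R s k)"
        using tk by (simp add: a_def scaleR_diff_right power2_eq_square)
      also have "\<dots> = c (Suc k) - c k"
        unfolding residual[OF k] c_def Suc_eq_plus1 residual_lam[OF k] using params
        by (simp add: scaleR_diff_right scaleR_add_right)
      finally show "a (Suc k) - (t (k + 1) * (t (k + 1) - 1) / (t k)\<^sup>2) *\<^sub>R a k
          = c (Suc k) - c k" .
    qed (use k in \<open>simp_all add: c_def\<close>)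
    also have "\<dots> \<le> C1"
    \<comment> \<open>The averaging lemma gives coefficient 2 at \<open>norm (a 1)\<close>, which
      the coefficient 3 in \<open>C1\<close> covers; the multiplier parts agree exactly.\<close>
    proof -
      have "norm (a 1) = (t 1)\<^sup>2 * norm (s 1)" by (simp add: a_def)
      moreover have "0 \<le> (t 1)\<^sup>2 * norm (s 1)" by simp
      ultimately show ?thesis
        unfolding C1 s_def[symmetric] R[symmetric] by (simp add: add_divide_distrib)
    qed
    finally show ?thesis
      using t_ge1[OF k] by (simp add: a_def field_simps)
  qed

  \<comment> \<open>Objective bound\<close>
  show ?thesis
  proof (intro allI impI)
    fix k :: nat assume k: "1 \<le> k"
    \<comment> \<open>The objective error is the gap minus \<open>inner ls (s k)\<close>. The gap
      lies between 0 and \<open>M / (t k)\<^sup>2\<close>, so both signs of the error are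
      controlled.\<close>
    have "\<bar>inner ls (s k)\<bar> \<le> norm ls * norm (s k)" by (rule Cauchy_Schwarz_ineq2)
    also have "\<dots> \<le> norm ls * (C1 / (t k)\<^sup>2)"
      using feas_bound[OF k] by (intro mult_left_mono) auto
    finally have "\<bar>rf (x k) + rg (y k) - rf xs - rg ys\<bar> \<le> M / (t k)\<^sup>2 + C1 * norm ls / (t k)\<^sup>2"
      using value_bound[OF k] h_nonneg[OF k] unfolding h_def by (simp add: mult.commute)
    then have "\<bar>f (x k) + g (y k) - f xs - g ys\<bar> \<le> ereal ((M + C1 * norm ls) / (t k)\<^sup>2)"
      using dom[OF k] opt by (simp add: f_real g_real add_divide_distrib)
    then show "L (x k) (y k) ls - L xs ys ls
        \<le> ereal ((E1 + \<gamma> * (t 2)\<^sup>2 / 2 * (norm (B *v (y 1 - ys)))\<^sup>2) / (t k)\<^sup>2) \<and>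
      norm (A *v x k + B *v y k - b) \<le> C1 / (t k)\<^sup>2 \<and>
      \<bar>f (x k) + g (y k) - f xs - g ys\<bar>
        \<le> ereal ((E1 + \<gamma> * (t 2)\<^sup>2 / 2 * (norm (B *v (y 1 - ys)))\<^sup>2 + C1 * norm ls)
                  / (t k)\<^sup>2)"
      using value_bound[OF k] feas_bound[OF k] unfolding gap[OF k] M_def s_def by simp
  qed
qed

end
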